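(* For every positive integer $m$ and every $f\in\mathcal F^m$ (given by its $m$ values), the sketch vector $V_f\in\mathbb R^m$ with $\Phi(z)=\exp(-z)$ can be computed in $O(m\log m)$ time.
   Context: $[m]=\{0,\dots,m-1\}$, with indices taken modulo $m$. $\mathcal F^m$ is the set of functions $f:[m]\to\mathbb A$, where $\mathbb A$ is the set of real algebraic numbers. The sketch is $V_f(k)=\frac1m\sum_{j\in[m]}\Phi(f(j)-f(j+k))$ for $k\in[m]$. Time counts arithmetic operations on real/complex numbers, with exponentials of given numbers and roots of unity available at unit cost. *)

theory Defs
  imports
    "HOL-Analysis.Analysis"
    "HOL-Computational_Algebra.Polynomial"
    "HOL-Library.Landau_Symbols"
    "HOL-Library.FuncSet"
begin

section \<open>Functions on [m] and their sketches\<close>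

definition alg_funs :: "nat \<Rightarrow> (nat \<Rightarrow> real) set" where
  "alg_funs m = {..<m} \<rightarrow>\<^sub>E {x. algebraic x}"

definition sketch :: "(real \<Rightarrow> real) \<Rightarrow> nat \<Rightarrow> (nat \<Rightarrow> real) \<Rightarrow> nat \<Rightarrow> real" where
  "sketch \<Phi> m f k = (1 / real m) * (\<Sum>j<m. \<Phi> (f j - f ((j + k) mod m)))"


section \<open>The machine model\<close>

text \<open>
  A uniform random access machine. A program is one finite piece of syntax that serves inputs of
  every length. It works on natural-number variables, which are used for indices and loop control,
  and on arrays of complex numbers. A program mentions only finitely many variables and arrays;
  all arrays are unbounded.

  On complex numbers the machine has the field operations, the exponential of a computed number,
  and roots of unity. The only literals are natural numbers. No test on complex numbers and no
  conversion from complex to natural numbers is available, so the control flow and the values of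
  all index variables depend on the input length alone.

  Every operation is charged one unit: each node of an expression, each assignment and each
  evaluation of a test. Index operations are thus counted as well, so that the time bounds the
  number of arithmetic operations on complex numbers from above.
\<close>

datatype iexp =
    IVar nat
  | INum nat
  | IAdd iexp iexp
  | ISub iexp iexp
  | IMul iexp iexp
  | IDiv iexp iexp
  | IMod iexp iexp

datatype cexp =
    CGet nat iexp     \<comment> \<open>array name and index\<close>
  | CNat iexp
  | CRoot iexp iexp   \<comment> \<open>\<open>CRoot a b\<close> is exp (2 pi i a / b)\<close>
  | CAdd cexp cexp
  | CSub cexp cexp
  | CMul cexp cexp
  | CDiv cexp cexp
  | CExp cexp

datatype com =
    SKIP
  | ISet nat iexp
  | CSet nat iexp cexp      \<comment> \<open>array name, index, new value\<close>
  | SEQ com com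
  | IFLESS iexp iexp com com
  | WHILELESS iexp iexp com

record state =
  ivar :: "nat \<Rightarrow> nat"
  arr  :: "nat \<Rightarrow> nat \<Rightarrow> complex"

fun ival :: "iexp \<Rightarrow> state \<Rightarrow> nat" where
  "ival (IVar x) s = ivar s x"
| "ival (INum n) s = n"
| "ival (IAdd a b) s = ival a s + ival b s"
| "ival (ISub a b) s = ival a s - ival b s"
| "ival (IMul a b) s = ival a s * ival b s"
| "ival (IDiv a b) s = ival a s div ival b s"
| "ival (IMod a b) s = ival a s mod ival b s"

fun icost :: "iexp \<Rightarrow> nat" where
  "icost (IVar x) = 1"
| "icost (INum n) = 1"
| "icost (IAdd a b) = 1 + icost a + icost b"
| "icost (ISub a b) = 1 + icost a + icost b"
| "icost (IMul a b) = 1 + icost a + icost b"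
| "icost (IDiv a b) = 1 + icost a + icost b"
| "icost (IMod a b) = 1 + icost a + icost b"

fun cval :: "cexp \<Rightarrow> state \<Rightarrow> complex" where
  "cval (CGet A i) s = arr s A (ival i s)"
| "cval (CNat i) s = of_nat (ival i s)"
| "cval (CRoot a b) s = exp (2 * of_real pi * \<i> * of_nat (ival a s) / of_nat (ival b s))"
| "cval (CAdd u v) s = cval u s + cval v s"
| "cval (CSub u v) s = cval u s - cval v s"
| "cval (CMul u v) s = cval u s * cval v s"
| "cval (CDiv u v) s = cval u s / cval v s"
| "cval (CExp u) s = exp (cval u s)"

text \<open>
  The value of an expression may be used only if no division by zero occurs in it. This matters:
  with the convention \<open>x / 0 = 0\<close> division would amount to a test for zero.
\<close>

fun cdefined :: "cexp \<Rightarrow> state \<Rightarrow> bool" where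
  "cdefined (CGet A i) s \<longleftrightarrow> True"
| "cdefined (CNat i) s \<longleftrightarrow> True"
| "cdefined (CRoot a b) s \<longleftrightarrow> ival b s \<noteq> 0"
| "cdefined (CAdd u v) s \<longleftrightarrow> cdefined u s \<and> cdefined v s"
| "cdefined (CSub u v) s \<longleftrightarrow> cdefined u s \<and> cdefined v s"
| "cdefined (CMul u v) s \<longleftrightarrow> cdefined u s \<and> cdefined v s"
| "cdefined (CDiv u v) s \<longleftrightarrow> cdefined u s \<and> cdefined v s \<and> cval v s \<noteq> 0"
| "cdefined (CExp u) s \<longleftrightarrow> cdefined u s"

fun ccost :: "cexp \<Rightarrow> nat" where
  "ccost (CGet A i) = 1 + icost i"
| "ccost (CNat i) = 1 + icost i"
| "ccost (CRoot a b) = 1 + icost a + icost b"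
| "ccost (CAdd u v) = 1 + ccost u + ccost v"
| "ccost (CSub u v) = 1 + ccost u + ccost v"
| "ccost (CMul u v) = 1 + ccost u + ccost v"
| "ccost (CDiv u v) = 1 + ccost u + ccost v"
| "ccost (CExp u) = 1 + ccost u"

text \<open>
  \<open>exec c s t s'\<close>: started in \<open>s\<close>, the command \<open>c\<close> terminates in \<open>s'\<close> after time \<open>t\<close>.
  A command that uses an undefined value has no outcome.
\<close>

inductive exec :: "com \<Rightarrow> state \<Rightarrow> nat \<Rightarrow> state \<Rightarrow> bool" where
  Skip: "exec SKIP s 1 s"
| ISet: "exec (ISet x a) s (1 + icost a) (s\<lparr>ivar := (ivar s)(x := ival a s)\<rparr>)"
| CSet: "cdefined u s \<Longrightarrow>
    exec (CSet A i u) s (1 + icost i + ccost u)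
      (s\<lparr>arr := (arr s)(A := (arr s A)(ival i s := cval u s))\<rparr>)"
| Seq: "exec c1 s t1 s' \<Longrightarrow> exec c2 s' t2 s'' \<Longrightarrow> exec (SEQ c1 c2) s (t1 + t2) s''"
| IfTrue: "ival a s < ival b s \<Longrightarrow> exec c1 s t s' \<Longrightarrow>
    exec (IFLESS a b c1 c2) s (1 + icost a + icost b + t) s'"
| IfFalse: "\<not> ival a s < ival b s \<Longrightarrow> exec c2 s t s' \<Longrightarrow>
    exec (IFLESS a b c1 c2) s (1 + icost a + icost b + t) s'"
| WhileFalse: "\<not> ival a s < ival b s \<Longrightarrow>
    exec (WHILELESS a b c) s (1 + icost a + icost b) s"
| WhileTrue: "ival a s < ival b s \<Longrightarrow> exec c s t1 s' \<Longrightarrow>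
    exec (WHILELESS a b c) s' t2 s'' \<Longrightarrow>
    exec (WHILELESS a b c) s (1 + icost a + icost b + t1 + t2) s''"

text \<open>
  Initially variable 0 holds the length of the input, array 0 holds the input, and everything
  else is zero. The output is read from array 1.
\<close>

definition init_state :: "nat \<Rightarrow> (nat \<Rightarrow> real) \<Rightarrow> state" where
  "init_state m x =
    \<lparr>ivar = (\<lambda>_. 0)(0 := m),
     arr = (\<lambda>_ _. 0)(0 := (\<lambda>j. if j < m then complex_of_real (x j) else 0))\<rparr>"

definition computes_within ::
    "com \<Rightarrow> nat \<Rightarrow> (nat \<Rightarrow> real) \<Rightarrow> (nat \<Rightarrow> real) \<Rightarrow> nat \<Rightarrow> bool" where
  "computes_within c m x y T \<longleftrightarrow>
    (\<exists>t s. exec c (init_state m x) t s \<and> t \<le> T \<and> (\<forall>k<m. arr s 1 k = complex_of_real (y k)))"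

end

theory Submission
  imports Defs
begin

text \<open>
  Up to the factor \<open>1 / m\<close>, the sketch is the cyclic correlation of the vectors \<open>exp (- f j)\<close> and
  \<open>exp (f j)\<close>. Padding the first with zeros and continuing the second \<open>m\<close>-periodically turns it
  into a correlation modulo a power of two \<open>n \<ge> 2 * m\<close>, since \<open>j + k < 2 * m\<close> never wraps around.
  With \<open>w\<close> a primitive \<open>n\<close>-th root of unity, orthogonality gives for the transforms
  \<open>X r = (\<Sum>j<n. x j * w ^ (r * j))\<close> and likewise \<open>Y\<close> the symmetric identity
  \<open>(\<Sum>r<n. X r * Y r * w ^ (r * k)) = n * (\<Sum>x j * y i)\<close>, the sum being over all \<open>i, j < n\<close>
  with \<open>n dvd i + j + k\<close>. So if \<open>y\<close> is the index-reversed second vector, three forward fast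
  Fourier transforms suffice and no inverse transform is needed.
\<close>

section \<open>Roots of unity and the discrete Fourier transform\<close>

definition unit_root :: "nat \<Rightarrow> nat \<Rightarrow> complex" where
  "unit_root n k = exp (2 * of_real pi * \<i> * of_nat k / of_nat n)"

definition dft :: "nat \<Rightarrow> (nat \<Rightarrow> complex) \<Rightarrow> nat \<Rightarrow> complex" where
  "dft n x r = (\<Sum>t<n. x t * unit_root n (r * t))"

lemma unit_root_add: "unit_root n (j + k) = unit_root n j * unit_root n k"
  by (simp add: unit_root_def exp_add[symmetric] add_divide_distrib ring_distribs)

lemma unit_root_0 [simp]: "unit_root n 0 = 1"
  by (simp add: unit_root_def)

lemma unit_root_mult: "unit_root n (r * k) = unit_root n k ^ r"
  by (induction r) (auto simp: unit_root_add)

lemma unit_root_eq_1_iff: "n > 0 \<Longrightarrow> unit_root n k = 1 \<longleftrightarrow> n dvd k"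
  using complex_root_unity_eq_1[of n k] by (simp add: unit_root_def)

lemma unit_root_cancel: "c > 0 \<Longrightarrow> unit_root (c * n) (c * k) = unit_root n k"
  by (simp add: unit_root_def mult.assoc)

lemma unit_root_mod: "n > 0 \<Longrightarrow> unit_root n (k mod n * t) = unit_root n (k * t)"
proof -
  assume n: "n > 0"
  have "k * t = n * (k div n * t) + k mod n * t"
    by (metis add_mult_distrib mult.assoc mult_div_mod_eq)
  moreover have "unit_root n (n * (k div n * t)) = 1"
    using n by (simp add: unit_root_eq_1_iff)
  ultimately show ?thesis
    by (metis unit_root_add mult_1)
qed

text \<open>Orthogonality as a geometric sum: the ratio \<open>unit_root n k\<close> is an
  \<open>n\<close>-th root of unity, so the sum vanishes unless the ratio is 1.\<close>

lemma sum_unit_root: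
  assumes "n > 0"
  shows "(\<Sum>r<n. unit_root n (r * k)) = (if n dvd k then of_nat n else 0)"
proof (cases "n dvd k")
  case True
  then have "unit_root n k = 1" using assms by (simp add: unit_root_eq_1_iff)
  then show ?thesis using True by (simp add: unit_root_mult)
next
  case False
  then have "unit_root n k \<noteq> 1" using assms by (simp add: unit_root_eq_1_iff)
  moreover have "unit_root n k ^ n = 1"
    using assms by (simp add: unit_root_mult[symmetric] unit_root_eq_1_iff)
  ultimately show ?thesis
    using False by (simp add: unit_root_mult geometric_sum)
qed

lemma dft_product:
  assumes "n > 0"
  shows "dft n (\<lambda>r. dft n x r * dft n y r) k =
    of_nat n * (\<Sum>j<n. \<Sum>i<n. if n dvd i + j + k then x j * y i else 0)"
proof -
  have "dft n (\<lambda>r. dft n x r * dft n y r) k =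
      (\<Sum>r<n. \<Sum>j<n. \<Sum>i<n. x j * y i * unit_root n (r * (i + j + k)))"
    unfolding dft_def sum_product sum_distrib_right
    by (simp add: unit_root_add ring_distribs mult_ac sum_distrib_left)
  also have "\<dots> = (\<Sum>j<n. \<Sum>i<n. \<Sum>r<n. x j * y i * unit_root n (r * (i + j + k)))"
    by (subst sum.swap) (intro sum.cong refl sum.swap)
  also have "\<dots> = of_nat n * (\<Sum>j<n. \<Sum>i<n. if n dvd i + j + k then x j * y i else 0)"
  proof -
    have "(\<Sum>r<n. x j * y i * unit_root n (r * (i + j + k))) =
        of_nat n * (if n dvd i + j + k then x j * y i else 0)" for i j
      by (subst sum_distrib_left[symmetric], subst sum_unit_root[OF assms]) simp
    then show ?thesis by (simp only: sum_distrib_left)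
  qed
  finally show ?thesis .
qed

section \<open>Splitting a transform into its even and odd halves\<close>

definition strided_dft :: "nat \<Rightarrow> nat \<Rightarrow> (nat \<Rightarrow> complex) \<Rightarrow> nat \<Rightarrow> nat \<Rightarrow> complex" where
  "strided_dft M L x q r = dft L (\<lambda>t. x (q + M * t)) r"

text \<open>
  On the left \<open>r\<close> ranges up to \<open>2 * L\<close>: the factor \<open>unit_root (2 * L) r\<close> contains the minus sign
  of the second half.
\<close>

lemma strided_dft_double:
  assumes "L > 0"
  shows "strided_dft M (2 * L) x q r =
    strided_dft (2 * M) L x q (r mod L) +
    unit_root (2 * L) r * strided_dft (2 * M) L x (q + M) (r mod L)"
proof -
  have split: "(\<Sum>t<2 * L. g t) = (\<Sum>t<L. g (2 * t)) + (\<Sum>t<L. g (2 * t + 1))" 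
    for g :: "nat \<Rightarrow> complex"
    by (induction L) auto
  have "unit_root (2 * L) (r * (2 * t)) = unit_root L (r * t)" for t
    using unit_root_cancel[of 2 L "r * t"] by (simp add: mult_ac)
  then show ?thesis
    unfolding strided_dft_def dft_def split unit_root_mod[OF assms] sum_distrib_left
    by (simp add: unit_root_add ring_distribs ac_simps)
qed

section \<open>Time-bounded total correctness of commands\<close>

definition terminates_within :: "com \<Rightarrow> state \<Rightarrow> nat \<Rightarrow> (state \<Rightarrow> bool) \<Rightarrow> bool" where
  "terminates_within c s T P \<longleftrightarrow> (\<exists>t s'. exec c s t s' \<and> t \<le> T \<and> P s')"

lemma terminates_within_mono:
  "terminates_within c s T P \<Longrightarrow> T \<le> T' \<Longrightarrow> (\<And>s'. P s' \<Longrightarrow> Q s') \<Longrightarrow> terminates_within c s T' Q"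
  unfolding terminates_within_def by (meson order_trans)

lemma terminates_within_ISet:
  "P (s\<lparr>ivar := (ivar s)(x := ival a s)\<rparr>) \<Longrightarrow> terminates_within (ISet x a) s (1 + icost a) P"
  unfolding terminates_within_def by (blast intro: exec.ISet)

lemma terminates_within_CSet:
  "cdefined u s \<Longrightarrow> P (s\<lparr>arr := (arr s)(A := (arr s A)(ival i s := cval u s))\<rparr>) \<Longrightarrow>
    terminates_within (CSet A i u) s (1 + icost i + ccost u) P"
  unfolding terminates_within_def by (blast intro: exec.CSet)

lemma terminates_within_SEQ:
  assumes "terminates_within c1 s t1 P" "\<And>s'. P s' \<Longrightarrow> terminates_within c2 s' t2 Q"
  shows "terminates_within (SEQ c1 c2) s (t1 + t2) Q"
  using assms unfolding terminates_within_def by (meson exec.Seq add_mono)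

text \<open>The invariant is indexed by the number of completed rounds, so exactly \<open>n\<close>
  rounds are run. Charging \<open>n + 1\<close> full rounds also pays for the final failing
  test.\<close>

lemma terminates_within_WHILELESS:
  assumes step: "\<And>i s. i < n \<Longrightarrow> I i s \<Longrightarrow>
      ival a s < ival b s \<and> terminates_within c s K (I (Suc i))"
    and stop: "\<And>s. I n s \<Longrightarrow> \<not> ival a s < ival b s"
    and init: "I 0 s"
  shows "terminates_within (WHILELESS a b c) s ((n + 1) * (1 + icost a + icost b + K)) (I n)"
proof -
  have "terminates_within (WHILELESS a b c) s ((n - i + 1) * (1 + icost a + icost b + K)) (I n)"
    if "i \<le> n" "I i s" for i s
    using that
  proof (induction arbitrary: s rule: inc_induct)
    case base
    have "1 + icost a + icost b \<le> (n - n + 1) * (1 + icost a + icost b + K)"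
      by simp
    with base stop[OF base] show ?case
      unfolding terminates_within_def by (blast intro: exec.WhileFalse)
  next
    case (step i)
    then obtain t s' where *: "ival a s < ival b s" "exec c s t s'" "t \<le> K" "I (Suc i) s'"
      using assms(1) unfolding terminates_within_def by meson
    from step.IH[OF *(4)] obtain t' s'' where **: "exec (WHILELESS a b c) s' t' s''"
      "t' \<le> (n - Suc i + 1) * (1 + icost a + icost b + K)" "I n s''"
      unfolding terminates_within_def by blast
    have "n - i = Suc (n - Suc i)" using step.hyps by simp
    then have "1 + icost a + icost b + t + t' \<le> (n - i + 1) * (1 + icost a + icost b + K)"
      using **(2) *(3) by simp
    then show ?case
      unfolding terminates_within_def using exec.WhileTrue[OF *(1,2) **(1)] **(3) by blast
  qed
  from this[of 0] init show ?thesis by simp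
qed

definition fill :: "nat \<Rightarrow> nat \<Rightarrow> iexp \<Rightarrow> cexp \<Rightarrow> com" where
  "fill A h off u = SEQ (ISet 2 (INum 0)) (WHILELESS (IVar 2) (IVar h)
    (SEQ (CSet A (IAdd off (IVar 2)) u) (ISet 2 (IAdd (IVar 2) (INum 1)))))"

text \<open>\<open>eval\<close> may rely on the part of \<open>A\<close> below \<open>b\<close>
  being unchanged, so \<open>u\<close> may read a lower block of the very array being filled, as
  each Fourier level does. A round costs \<open>icost off + ccost u + 10\<close>; the constant 12
  absorbs the initial assignment.\<close>

lemma terminates_within_fill:
  assumes "h \<noteq> 2" "ivar s h = n"
    and eval: "\<And>i s'. i < n \<Longrightarrow> ivar s' = (ivar s)(2 := i) \<Longrightarrow> (\<And>B. B \<noteq> A \<Longrightarrow> arr s' B = arr s B) \<Longrightarrow>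
      (\<And>x. x < b \<Longrightarrow> arr s' A x = arr s A x) \<Longrightarrow>
      ival off s' = b \<and> cdefined u s' \<and> cval u s' = v i"
  shows "terminates_within (fill A h off u) s ((n + 1) * (icost off + ccost u + 12))
    (\<lambda>s'. ivar s' = (ivar s)(2 := n) \<and> (\<forall>B. B \<noteq> A \<longrightarrow> arr s' B = arr s B) \<and>
      (\<forall>x. arr s' A x = (if b \<le> x \<and> x < b + n then v (x - b) else arr s A x)))"
proof -
  define I :: "nat \<Rightarrow> state \<Rightarrow> bool" where "I i s' \<longleftrightarrow> ivar s' = (ivar s)(2 := i) \<and> (\<forall>B. B \<noteq> A \<longrightarrow> arr s' B = arr s B) \<and>
      (\<forall>x. arr s' A x = (if b \<le> x \<and> x < b + i then v (x - b) else arr s A x))" for i s'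
  let ?c = "SEQ (CSet A (IAdd off (IVar 2)) u) (ISet 2 (IAdd (IVar 2) (INum 1)))"
  have step: "ival (IVar 2) s' < ival (IVar h) s' \<and>
      terminates_within ?c s' ((1 + icost (IAdd off (IVar 2)) + ccost u) + 4) (I (Suc i))"
    if i: "i < n" and I: "I i s'" for i s'
  proof -
    have ev: "ival off s' = b \<and> cdefined u s' \<and> cval u s' = v i"
      using I i by (intro eval) (auto simp: I_def)
    have iv: "ivar s' = (ivar s)(2 := i)" using I by (simp add: I_def)
    define s2 where "s2 = s'\<lparr>arr := (arr s')(A := (arr s' A)(b + i := v i))\<rparr>"
    have "terminates_within ?c s' ((1 + icost (IAdd off (IVar 2)) + ccost u) + (1 + icost (IAdd (IVar 2) (INum 1)))) (I (Suc i))"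
    proof (rule terminates_within_SEQ[where P = "\<lambda>s. s = s2"])
      show "terminates_within (CSet A (IAdd off (IVar 2)) u) s'
         (1 + icost (IAdd off (IVar 2)) + ccost u) (\<lambda>s. s = s2)"
        using ev by (intro terminates_within_CSet) (simp_all add: s2_def iv)
      have "I (Suc i) (s2\<lparr>ivar := (ivar s2)(2 := ival (IAdd (IVar 2) (INum 1)) s2)\<rparr>)"
        using I by (auto simp: I_def s2_def)
      then show "terminates_within (ISet 2 (IAdd (IVar 2) (INum 1))) s3
          (1 + icost (IAdd (IVar 2) (INum 1))) (I (Suc i))" if "s3 = s2" for s3
        unfolding that by (rule terminates_within_ISet)
    qed
    then show ?thesis using iv i assms(1,2) by (simp add: eval_nat_numeral)
  qed
  have "terminates_within (fill A h off u) s ((1 + icost (INum 0)) +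
      (n + 1) * (1 + icost (IVar 2) + icost (IVar h) + ((1 + icost (IAdd off (IVar 2)) + ccost u) + 4))) (I n)"
    unfolding fill_def
  proof (rule terminates_within_SEQ[where P = "I 0"])
    show "terminates_within (ISet 2 (INum 0)) s (1 + icost (INum 0)) (I 0)"
      by (rule terminates_within_ISet) (auto simp: I_def)
    show "terminates_within (WHILELESS (IVar 2) (IVar h) ?c) s'
        ((n + 1) * (1 + icost (IVar 2) + icost (IVar h) + ((1 + icost (IAdd off (IVar 2)) + ccost u) + 4))) (I n)"
      if "I 0 s'" for s'
      using assms(1,2) that
      by (intro terminates_within_WHILELESS step) (auto simp: I_def)
  qed
  then show ?thesis
    by (rule terminates_within_mono) (auto simp: I_def)
qed

section \<open>The fast Fourier transform\<close>

text \<open>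
  The transform is in the self-sorting (Stockham) form, so that no bit reversal is needed. The
  \<open>2 ^ l\<close>-point transforms of the subsequences of stride \<open>M = 2 ^ (e - l)\<close> are stored at the fresh
  offset \<open>l * 2 ^ e\<close> of the same array, frequency \<open>r\<close> of the subsequence starting at \<open>q\<close> having
  the position \<open>r * M + q\<close>. Variables: 0 the input length, 1 the size \<open>2 ^ e\<close>, 2 the loop counter,
  3 the stride, 4 the offset.
\<close>

definition fft_butterfly :: "nat \<Rightarrow> cexp" where
  "fft_butterfly A =
    (let i = IVar 2; N = IVar 1; M = IVar 3; base = IVar 4; r = IDiv i M;
         src = IAdd base (IAdd (IMod (IMul r (IMul (INum 2) M)) N) (IMod i M))
     in CAdd (CGet A src) (CMul (CRoot r (IDiv N M)) (CGet A (IAdd src M))))"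

definition fft_level :: "nat \<Rightarrow> com" where
  "fft_level A =
    SEQ (ISet 3 (IDiv (IVar 3) (INum 2)))
   (SEQ (fill A 1 (IAdd (IVar 4) (IVar 1)) (fft_butterfly A))
        (ISet 4 (IAdd (IVar 4) (IVar 1))))"

definition fft :: "nat \<Rightarrow> com" where
  "fft A = SEQ (SEQ (ISet 3 (IVar 1)) (ISet 4 (INum 0)))
    (WHILELESS (INum 1) (IVar 3) (fft_level A))"

lemma ccost_fft_butterfly: "ccost (fft_butterfly A) = 43"
  by (simp add: fft_butterfly_def Let_def)

text \<open>\<open>s\<close> is the state on entry, \<open>s'\<close> the state after
  \<open>l\<close> levels. At level 0 the block is the input itself, viewed as one-point
  transforms.\<close>

definition fft_inv :: "nat \<Rightarrow> state \<Rightarrow> nat \<Rightarrow> nat \<Rightarrow> nat \<Rightarrow> state \<Rightarrow> bool" where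
  "fft_inv A s e M l s' \<longleftrightarrow>
    ivar s' 0 = ivar s 0 \<and> ivar s' 1 = 2 ^ e \<and> ivar s' 3 = M \<and> ivar s' 4 = l * 2 ^ e \<and>
    (\<forall>B. B \<noteq> A \<longrightarrow> arr s' B = arr s B) \<and>
    (\<forall>p<2 ^ e. arr s' A (l * 2 ^ e + p) = strided_dft M (2 ^ l) (arr s A) (p mod M) (p div M))"

text \<open>Each of the \<open>2 ^ e + 1\<close> charged rounds costs 58 and the two assignments
  cost 8; since \<open>2 ^ e + 1 \<ge> 2\<close>, 62 per round covers both.\<close>

lemma terminates_within_fft_level:
  assumes "l < e" and inv: "fft_inv A s e (2 ^ (e - l)) l s1"
  shows "terminates_within (fft_level A) s1 (62 * (2 ^ e + 1)) (fft_inv A s e (2 ^ (e - Suc l)) (Suc l))"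
proof -
  define M L N :: nat where "M = 2 ^ (e - Suc l)" and "L = 2 ^ l" and "N = 2 ^ e"
  have M2: "2 ^ (e - l) = 2 * M"
    using assms(1) by (simp add: M_def Suc_diff_Suc[symmetric])
  have N: "N = L * (2 * M)"
    using assms(1) by (simp add: M2[symmetric] L_def N_def flip: power_add)
  have pos: "M > 0" "L > 0" "N > 0" by (auto simp: M_def L_def N_def)
  note inv = inv[unfolded fft_inv_def M2, folded N_def L_def]
  define s2 where "s2 = s1\<lparr>ivar := (ivar s1)(3 := M)\<rparr>"
  define P :: "state \<Rightarrow> bool" where "P s3 \<longleftrightarrow> ivar s3 = (ivar s2)(2 := N) \<and> (\<forall>B. B \<noteq> A \<longrightarrow> arr s3 B = arr s2 B) \<and>
      (\<forall>x. arr s3 A x = (if l * N + N \<le> x \<and> x < l * N + N + N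
        then strided_dft M (2 * L) (arr s A) ((x - (l * N + N)) mod M) ((x - (l * N + N)) div M)
        else arr s2 A x))" for s3
  have read: "arr s1 A (l * N + (a mod L * (2 * M) + q)) = strided_dft (2 * M) L (arr s A) q (a mod L)"
    if "q < 2 * M" for a q
  proof -
    have "a mod L * (2 * M) + q < Suc (a mod L) * (2 * M)" using that by simp
    also have "\<dots> \<le> N" unfolding N using pos by (intro mult_right_mono) (simp_all add: Suc_leI)
    finally show ?thesis using inv that by simp
  qed
  have fillP: "terminates_within (fill A 1 (IAdd (IVar 4) (IVar 1)) (fft_butterfly A)) s2
    ((N + 1) * (icost (IAdd (IVar 4) (IVar 1)) + ccost (fft_butterfly A) + 12)) P"
    unfolding P_def
  proof (rule terminates_within_fill)
    show "ivar s2 1 = N" using inv by (simp add: s2_def)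
    fix i and s' :: state assume i: "i < N" "ivar s' = (ivar s2)(2 := i)"
      and same: "\<And>x. x < l * N + N \<Longrightarrow> arr s' A x = arr s2 A x"
    define r q where "r = i div M" and "q = i mod M"
    have q: "q < M" using pos by (simp add: q_def)
    \<comment> \<open>The program never stores \<open>L\<close>; as \<open>N = L * (2 * M)\<close>,
      reducing modulo \<open>N\<close> reduces the frequency modulo \<open>L\<close>.\<close>
    have src: "(r * (2 * M)) mod N = r mod L * (2 * M)"
      unfolding N by (simp add: mult_mod_left)
    have lt: "r mod L * (2 * M) + (q + M) < N"
    proof -
      have "r mod L * (2 * M) + (q + M) < Suc (r mod L) * (2 * M)" using q by simp
      also have "\<dots> \<le> N" unfolding N using pos by (intro mult_right_mono) (simp_all add: Suc_leI)
      finally show ?thesis .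
    qed
    have NM: "N div M = 2 * L" using pos by (simp add: N)
    have iv: "ivar s' (Suc 0) = N" "ivar s' 2 = i" "ivar s' 3 = M" "ivar s' 4 = l * N"
      using i(2) inv by (simp_all add: s2_def)
    \<comment> \<open>Both operands lie in the block at \<open>l * N\<close>, below the region being
      written, so \<open>same\<close> applies.\<close>
    have g1: "arr s' A (l * N + (r mod L * (2 * M) + q)) = strided_dft (2 * M) L (arr s A) q (r mod L)"
      using lt q by (subst same) (simp_all add: s2_def read)
    have g2: "arr s' A (l * N + (r mod L * (2 * M) + (q + M))) = strided_dft (2 * M) L (arr s A) (q + M) (r mod L)"
      using lt q by (subst same) (simp_all add: s2_def read)
    have "cval (fft_butterfly A) s' = arr s' A (l * N + (r mod L * (2 * M) + q)) +
        unit_root (2 * L) r * arr s' A (l * N + (r mod L * (2 * M) + (q + M)))"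
      by (simp add: fft_butterfly_def Let_def iv NM unit_root_def src[symmetric] add.assoc flip: r_def q_def)
    also have "\<dots> = strided_dft M (2 * L) (arr s A) q r"
      unfolding g1 g2 by (rule strided_dft_double[symmetric]) (rule pos)
    finally show "ival (IAdd (IVar 4) (IVar 1)) s' = l * N + N \<and> cdefined (fft_butterfly A) s' \<and>
      cval (fft_butterfly A) s' = strided_dft M (2 * L) (arr s A) (i mod M) (i div M)"
      using pos by (simp add: iv r_def q_def) (simp add: fft_butterfly_def Let_def iv NM)
  qed simp
  have "terminates_within (fft_level A) s1 ((1 + icost (IDiv (IVar 3) (INum 2))) +
      (((N + 1) * (icost (IAdd (IVar 4) (IVar 1)) + ccost (fft_butterfly A) + 12)) +
       (1 + icost (IAdd (IVar 4) (IVar 1))))) (fft_inv A s e (2 ^ (e - Suc l)) (Suc l))"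
    unfolding fft_level_def
  proof (rule terminates_within_SEQ[where P = "\<lambda>s. s = s2"])
    show "terminates_within (ISet 3 (IDiv (IVar 3) (INum 2))) s1
      (1 + icost (IDiv (IVar 3) (INum 2))) (\<lambda>s. s = s2)"
      using inv by (intro terminates_within_ISet) (simp add: s2_def)
    show "terminates_within (SEQ (fill A 1 (IAdd (IVar 4) (IVar 1)) (fft_butterfly A))
        (ISet 4 (IAdd (IVar 4) (IVar 1)))) s3
      (((N + 1) * (icost (IAdd (IVar 4) (IVar 1)) + ccost (fft_butterfly A) + 12)) +
       (1 + icost (IAdd (IVar 4) (IVar 1)))) (fft_inv A s e (2 ^ (e - Suc l)) (Suc l))"
      if "s3 = s2" for s3
      unfolding that
    proof (rule terminates_within_SEQ[OF fillP])
      fix s3 assume "P s3"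
      then show "terminates_within (ISet 4 (IAdd (IVar 4) (IVar 1))) s3
        (1 + icost (IAdd (IVar 4) (IVar 1))) (fft_inv A s e (2 ^ (e - Suc l)) (Suc l))"
        using inv
        by (intro terminates_within_ISet)
           (simp add: fft_inv_def P_def s2_def algebra_simps flip: M_def L_def N_def)
    qed
  qed
  then show ?thesis
    by (rule terminates_within_mono) (auto simp: ccost_fft_butterfly N_def)
qed

text \<open>The stride halves from \<open>2 ^ e\<close> to 1 in \<open>e\<close> levels; at stride 1
  the only subsequence left is the whole input.\<close>

lemma terminates_within_fft:
  assumes "ivar s 1 = 2 ^ e"
  shows "terminates_within (fft A) s (135 * (2 ^ e * (e + 1)))
    (\<lambda>s'. ivar s' 0 = ivar s 0 \<and> ivar s' 1 = 2 ^ e \<and> ivar s' 4 = e * 2 ^ e \<and>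
      (\<forall>B. B \<noteq> A \<longrightarrow> arr s' B = arr s B) \<and>
      (\<forall>r<2 ^ e. arr s' A (e * 2 ^ e + r) = dft (2 ^ e) (arr s A) r))"
proof -
  define I where "I l = fft_inv A s e (2 ^ (e - l)) l" for l
  have "terminates_within (fft A) s (((1 + icost (IVar 1)) + (1 + icost (INum 0))) +
      (e + 1) * (1 + icost (INum 1) + icost (IVar 3) + 62 * (2 ^ e + 1))) (I e)"
    unfolding fft_def
  proof (rule terminates_within_SEQ[where P = "I 0"])
    define s1 where "s1 = s\<lparr>ivar := (ivar s)(3 := 2 ^ e)\<rparr>"
    show "terminates_within (SEQ (ISet 3 (IVar 1)) (ISet 4 (INum 0))) s
      ((1 + icost (IVar 1)) + (1 + icost (INum 0))) (I 0)"
    proof (rule terminates_within_SEQ[where P = "\<lambda>s. s = s1"])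
      show "terminates_within (ISet 3 (IVar 1)) s (1 + icost (IVar 1)) (\<lambda>s. s = s1)"
        using assms by (intro terminates_within_ISet) (simp add: s1_def)
      show "terminates_within (ISet 4 (INum 0)) s' (1 + icost (INum 0)) (I 0)" if "s' = s1" for s'
        unfolding that using assms
        by (intro terminates_within_ISet)
           (simp add: I_def fft_inv_def s1_def strided_dft_def dft_def)
    qed
    show "terminates_within (WHILELESS (INum 1) (IVar 3) (fft_level A)) s'
      ((e + 1) * (1 + icost (INum 1) + icost (IVar 3) + 62 * (2 ^ e + 1))) (I e)" if "I 0 s'" for s'
    proof (rule terminates_within_WHILELESS[where I = I, OF _ _ that])
      show "ival (INum 1) s2 < ival (IVar 3) s2 \<and>
        terminates_within (fft_level A) s2 (62 * (2 ^ e + 1)) (I (Suc l))" if "l < e" "I l s2" for l s2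
        using that terminates_within_fft_level[of l e A s s2] one_less_power[of "2::nat" "e - l"]
        by (simp add: I_def) (simp add: fft_inv_def)
    qed (simp add: I_def fft_inv_def)
  qed
  moreover have "((1 + icost (IVar 1)) + (1 + icost (INum 0))) +
      (e + 1) * (1 + icost (INum 1) + icost (IVar 3) + 62 * (2 ^ e + 1)) \<le> 135 * (2 ^ e * (e + 1))"
  proof -
    have "4 + (e + 1) * (65 + 62 * (2::nat) ^ e) \<le> 4 * (e + 1) + (e + 1) * (65 + 62 * 2 ^ e)" by simp
    also have "\<dots> = (e + 1) * (69 + 62 * 2 ^ e)" by (simp add: algebra_simps)
    also have "\<dots> \<le> (e + 1) * (135 * 2 ^ e)"
      using one_le_power[of "2::nat" e] by (intro mult_left_mono) linarith+
    finally show ?thesis by (simp add: algebra_simps)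
  qed
  ultimately show ?thesis
    by (rule terminates_within_mono) (auto simp: I_def fft_inv_def strided_dft_def)
qed


section \<open>The sketch as a cyclic correlation\<close>

lemma dft_cong: "(\<And>t. t < n \<Longrightarrow> x t = y t) \<Longrightarrow> dft n x = dft n y"
  by (simp add: dft_def fun_eq_iff)

definition corr_left :: "nat \<Rightarrow> (nat \<Rightarrow> real) \<Rightarrow> nat \<Rightarrow> complex" where
  "corr_left m f j = (if j < m then exp (- of_real (f j)) else 0)"

text \<open>\<open>(n - i) mod n\<close> represents \<open>- i\<close> modulo \<open>n\<close>, also
  for \<open>i = 0\<close>. The reversal precedes the reduction modulo \<open>m\<close> because
  \<open>n\<close> need not be a multiple of \<open>m\<close>.\<close>

definition corr_right :: "nat \<Rightarrow> nat \<Rightarrow> (nat \<Rightarrow> real) \<Rightarrow> nat \<Rightarrow> complex" where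
  "corr_right n m f i = exp (of_real (f ((n - i) mod n mod m)))"

text \<open>For each \<open>j < m\<close> a single \<open>i\<close> survives in
  \<open>dft_product\<close>. In the divisor, \<open>n\<close> comes from orthogonality and
  \<open>m\<close> from the mean.\<close>

lemma sketch_exp_conv_dft:
  assumes "0 < m" "2 * m \<le> n" "k < m"
  shows "of_real (sketch (\<lambda>z. exp (- z)) m f k) =
    dft n (\<lambda>r. dft n (corr_left m f) r * dft n (corr_right n m f) r) k / of_nat (n * m)"
proof -
  let ?x = "corr_left m f" and ?y = "corr_right n m f"
  have inner: "(\<Sum>i<n. if n dvd i + j + k then ?x j * ?y i else 0) =
      of_real (exp (- (f j - f ((j + k) mod m))))" if "j < m" for j
  proof -
    \<comment> \<open>\<open>i0\<close> represents \<open>- (j + k)\<close>; the final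
      \<open>mod n\<close> matters when \<open>j + k = 0\<close>.\<close>
    define i0 where "i0 = (n - (j + k)) mod n"
    have jk: "j + k < n" using assms that by simp
    have dvd: "n dvd i + j + k \<longleftrightarrow> i = i0" if "i < n" for i
    proof
      assume "n dvd i + j + k"
      then obtain c where c: "i + (j + k) = n * c" by (metis add.assoc dvdE)
      \<comment> \<open>The multiple of \<open>n\<close> lies below \<open>2 * n\<close>, hence is 0
        or \<open>n\<close>; the value 0 forces \<open>i = j = k = 0\<close>.\<close>
      have "n * c < n * 2" using that jk c by linarith
      then have "c = 0 \<or> c = 1" by auto
      then show "i = i0" using c jk that by (auto simp: i0_def)
    next
      assume i: "i = i0"
      show "n dvd i + j + k"
      proof (cases "j + k = 0")
        case False
        then have "i0 = n - (j + k)" using jk by (simp add: i0_def)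
        then show ?thesis using i jk by simp
      qed (simp add: i i0_def)
    qed
    have i0: "i0 < n" using jk by (simp add: i0_def)
    have "(\<Sum>i<n. if n dvd i + j + k then ?x j * ?y i else 0) =
        (\<Sum>i<n. if i = i0 then ?x j * ?y i else 0)"
      by (intro sum.cong refl) (simp add: dvd)
    also have "\<dots> = ?x j * ?y i0" using i0 by simp
    \<comment> \<open>The reversal inside \<open>?y\<close> undoes the negation in
      \<open>i0\<close>.\<close>
    also have "(n - i0) mod n = j + k"
      using jk by (cases "j + k = 0") (auto simp: i0_def)
    then have "?x j * ?y i0 = of_real (exp (- (f j - f ((j + k) mod m))))"
      using that by (simp add: corr_left_def corr_right_def exp_add[symmetric] exp_of_real[symmetric])
    finally show ?thesis .
  qed
  have "(\<Sum>j<n. \<Sum>i<n. if n dvd i + j + k then ?x j * ?y i else 0) =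
      (\<Sum>j<m. \<Sum>i<n. if n dvd i + j + k then ?x j * ?y i else 0)"
    using assms by (intro sum.mono_neutral_right) (auto simp: corr_left_def intro!: sum.neutral)
  also have "\<dots> = of_real (\<Sum>j<m. exp (- (f j - f ((j + k) mod m))))"
    by (simp add: inner del: exp_of_real)
  finally have *: "(\<Sum>j<n. \<Sum>i<n. if n dvd i + j + k then ?x j * ?y i else 0) =
      of_real (\<Sum>j<m. exp (- (f j - f ((j + k) mod m))))" .
  show ?thesis
    using assms by (subst dft_product) (simp_all only: *, simp_all add: sketch_def)
qed

section \<open>The transform size and the time bound\<close>

definition fft_exponent :: "nat \<Rightarrow> nat" where
  "fft_exponent m = (LEAST e. 2 * m \<le> 2 ^ e)"

lemma fft_exponent_ge: "2 * m \<le> 2 ^ fft_exponent m"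
  unfolding fft_exponent_def
  by (rule LeastI_ex) (metis less_exp less_imp_le)

lemma fft_exponent_less: "i < fft_exponent m \<Longrightarrow> 2 ^ i < 2 * m"
  unfolding fft_exponent_def by (meson not_less_Least not_le)

text \<open>By minimality the preceding power of two is still below \<open>2 * m\<close>.\<close>

lemma fft_exponent_le:
  assumes "m > 0"
  shows "2 ^ fft_exponent m \<le> 4 * m"
proof (cases "fft_exponent m")
  case 0
  then show ?thesis using assms by simp
next
  case (Suc i)
  then show ?thesis using fft_exponent_less[of i m] by simp
qed

text \<open>616 is 11 + 4 * 50 + 3 * 135: finding the size, four array passes and three
  transforms.\<close>

definition sketch_time :: "nat \<Rightarrow> nat" where
  "sketch_time m = 616 * (2 ^ fft_exponent m * (fft_exponent m + 1))"

text \<open>The factor 20 is 4 * 5, from \<open>2 ^ e \<le> 4 * m\<close> and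
  \<open>e + 1 \<le> 5 * ln m\<close>. From \<open>m = 3\<close> on, \<open>ln m \<ge> 1\<close>
  absorbs additive constants.\<close>

lemma sketch_time_bigo: "(\<lambda>m. real (sketch_time m)) \<in> O(\<lambda>m. real m * ln (real m))"
proof (rule bigoI[where c = "616 * 20"])
  have "real (sketch_time m) \<le> 616 * 20 * (real m * ln (real m))" if m: "m \<ge> 3" for m
  proof -
    define e where "e = fft_exponent m"
    have "real (2 ^ e) \<le> real (4 * m)"
      using fft_exponent_le[of m] m unfolding e_def of_nat_le_iff by simp
    then have "2 ^ e \<le> 4 * real m" by simp
    have ln_m: "1 \<le> ln (real m)"
      using m exp_le by (subst ln_ge_iff) auto
    have "ln (2 ^ e) \<le> ln (4 * real m)"
      using \<open>2 ^ e \<le> 4 * real m\<close> m by (subst ln_le_cancel_iff) auto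
    moreover have "ln (4 * real m) = 2 * ln 2 + ln (real m)"
      using m ln_realpow[of 2 2] by (simp add: ln_mult)
    ultimately have "(real e - 2) * ln 2 \<le> ln (real m)"
      by (simp add: ln_realpow algebra_simps)
    moreover have "(real e - 2) / 2 \<le> (real e - 2) * ln 2" if "e \<ge> 2"
    proof -
      have "1 / 2 \<le> ln (2::real)" using ln2_ge_two_thirds by simp
      then have "(real e - 2) * (1 / 2) \<le> (real e - 2) * ln 2"
        using that by (intro mult_left_mono) auto
      then show ?thesis by simp
    qed
    \<comment> \<open>If \<open>e \<ge> 2\<close>, then \<open>e \<le> 2 + 2 * ln m\<close>, so
      \<open>e + 1 \<le> 3 + 2 * ln m\<close>; otherwise \<open>e + 1 \<le> 2\<close>.\<close>
    ultimately have "real e + 1 \<le> 5 * ln (real m)"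
      using ln_m by (cases "e \<ge> 2") auto
    with \<open>2 ^ e \<le> 4 * real m\<close> have "2 ^ e * (real e + 1) \<le> (4 * real m) * (5 * ln (real m))"
      by (intro mult_mono) auto
    then show ?thesis by (simp add: sketch_time_def e_def algebra_simps)
  qed
  then show "\<forall>\<^sub>F m in sequentially. norm (real (sketch_time m)) \<le> 616 * 20 * norm (real m * ln (real m))"
    by (intro eventually_sequentiallyI[of 3]) (auto simp: abs_mult)
qed

section \<open>The program and its correctness\<close>

definition set_size :: com where
  "set_size = SEQ (ISet 1 (INum 1))
    (WHILELESS (IVar 1) (IMul (INum 2) (IVar 0)) (ISet 1 (IMul (IVar 1) (INum 2))))"

text \<open>Minimality of the exponent makes it the exact number of doublings. A round costs 9; the
  constant 11 absorbs the initial assignment.\<close>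

lemma terminates_within_set_size:
  assumes "ivar s 0 = m"
  shows "terminates_within set_size s (11 * (fft_exponent m + 1))
    (\<lambda>s'. ivar s' 0 = m \<and> ivar s' 1 = 2 ^ fft_exponent m \<and> arr s' = arr s)"
proof -
  define I :: "nat \<Rightarrow> state \<Rightarrow> bool"
    where "I i s' \<longleftrightarrow> ivar s' 0 = m \<and> ivar s' 1 = 2 ^ i \<and> arr s' = arr s" for i s'
  let ?e = "fft_exponent m"
  have "terminates_within set_size s ((1 + icost (INum 1)) + (?e + 1) *
      (1 + icost (IVar 1) + icost (IMul (INum 2) (IVar 0)) + (1 + icost (IMul (IVar 1) (INum 2))))) (I ?e)"
    unfolding set_size_def
  proof (rule terminates_within_SEQ[where P = "I 0"])
    show "terminates_within (ISet 1 (INum 1)) s (1 + icost (INum 1)) (I 0)"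
      using assms by (intro terminates_within_ISet) (simp add: I_def)
    show "terminates_within
        (WHILELESS (IVar 1) (IMul (INum 2) (IVar 0)) (ISet 1 (IMul (IVar 1) (INum 2)))) s'
        ((?e + 1) * (1 + icost (IVar 1) + icost (IMul (INum 2) (IVar 0)) +
          (1 + icost (IMul (IVar 1) (INum 2))))) (I ?e)" if "I 0 s'" for s'
    proof (rule terminates_within_WHILELESS[where I = I, OF _ _ that])
      show "ival (IVar 1) s2 < ival (IMul (INum 2) (IVar 0)) s2 \<and>
          terminates_within (ISet 1 (IMul (IVar 1) (INum 2))) s2
            (1 + icost (IMul (IVar 1) (INum 2))) (I (Suc i))" if "i < ?e" "I i s2" for i s2
        using that fft_exponent_less[of i m]
        by (intro conjI terminates_within_ISet) (simp_all add: I_def)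
    qed (use fft_exponent_ge[of m] in \<open>simp add: I_def\<close>)
  qed
  then show ?thesis
    by (rule terminates_within_mono) (auto simp: I_def)
qed

text \<open>Array 2 is filled only up to \<open>m\<close>: its initial zeros are the padding. Array
  3 receives the reversed vector and array 4 the product of the transforms. Every transform ends at
  the offset held in variable 4, which \<open>fill\<close> preserves.\<close>

definition sketch_prog :: com where
  "sketch_prog =
    SEQ set_size
   (SEQ (fill 2 0 (INum 0) (CExp (CSub (CNat (INum 0)) (CGet 0 (IVar 2)))))
   (SEQ (fill 3 1 (INum 0)
      (CExp (CGet 0 (IMod (IMod (ISub (IVar 1) (IVar 2)) (IVar 1)) (IVar 0)))))
   (SEQ (fft 2)
   (SEQ (fft 3)
   (SEQ (fill 4 1 (INum 0)
      (CMul (CGet 2 (IAdd (IVar 4) (IVar 2))) (CGet 3 (IAdd (IVar 4) (IVar 2)))))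
   (SEQ (fft 4)
        (fill 1 0 (INum 0)
      (CDiv (CGet 4 (IAdd (IVar 4) (IVar 2))) (CNat (IMul (IVar 1) (IVar 0)))))))))))"

text \<open>Brings the array passes, each of cost at most 25 a round, to the unit
  \<open>N * (e + 1)\<close> in which the transforms are measured.\<close>

lemma fill_cost_le:
  assumes "n \<le> N" "N > 0" "c \<le> 25"
  shows "(n + 1) * c \<le> 50 * (N * (e + 1 :: nat))"
proof -
  have "(n + 1) * c \<le> (2 * N) * 25" using assms by (intro mult_mono) auto
  then show ?thesis by simp
qed

lemma sketch_prog_correct:
  assumes m: "m > 0"
  shows "terminates_within sketch_prog (init_state m f) (sketch_time m)
    (\<lambda>s. \<forall>k<m. arr s 1 k = of_real (sketch (\<lambda>z. exp (- z)) m f k))"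
proof -
  define e where "e = fft_exponent m"
  define N :: nat where "N = 2 ^ e"
  define W where "W = N * (e + 1)"
  let ?x = "corr_left m f" and ?y = "corr_right N m f"
  have N: "2 * m \<le> N" "N > 0" "m \<le> N"
    using fft_exponent_ge[of m] by (auto simp: N_def e_def)
  \<comment> \<open>One assertion after each of the first seven phases, keeping what later phases
    read.\<close>
  define P1 where "P1 s \<longleftrightarrow> ivar s 0 = m \<and> ivar s 1 = N \<and> arr s = arr (init_state m f)" for s :: state
  define P2 where "P2 s \<longleftrightarrow> ivar s 0 = m \<and> ivar s 1 = N \<and>
    (\<forall>j<m. arr s 0 j = of_real (f j)) \<and> arr s 2 = ?x" for s :: state
  define P3 where "P3 s \<longleftrightarrow> ivar s 0 = m \<and> ivar s 1 = N \<and> arr s 2 = ?x \<and>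
    (\<forall>i<N. arr s 3 i = ?y i)" for s :: state
  define P4 where "P4 s \<longleftrightarrow> ivar s 0 = m \<and> ivar s 1 = N \<and> (\<forall>i<N. arr s 3 i = ?y i) \<and>
    (\<forall>r<N. arr s 2 (e * N + r) = dft N ?x r)" for s :: state
  define P5 where "P5 s \<longleftrightarrow> ivar s 0 = m \<and> ivar s 1 = N \<and> ivar s 4 = e * N \<and>
    (\<forall>r<N. arr s 2 (e * N + r) = dft N ?x r) \<and> (\<forall>r<N. arr s 3 (e * N + r) = dft N ?y r)" for s :: state
  define P6 where "P6 s \<longleftrightarrow> ivar s 0 = m \<and> ivar s 1 = N \<and>
    (\<forall>r<N. arr s 4 r = dft N ?x r * dft N ?y r)" for s :: state
  define P7 where "P7 s \<longleftrightarrow> ivar s 0 = m \<and> ivar s 1 = N \<and> ivar s 4 = e * N \<and>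
    (\<forall>k<N. arr s 4 (e * N + k) = dft N (\<lambda>r. dft N ?x r * dft N ?y r) k)" for s :: state
  \<comment> \<open>The summands follow the eight phases and are nested like the \<open>SEQ\<close>
    commands, so the sequence rule splits the budget syntactically.\<close>
  have time: "sketch_time m = 11 * W + (50 * W + (50 * W + (135 * W + (135 * W +
      (50 * W + (135 * W + 50 * W))))))"
    by (simp add: sketch_time_def W_def N_def e_def)
  show ?thesis
    unfolding sketch_prog_def time
  proof (rule terminates_within_SEQ[where P = P1], goal_cases)
    case 1
    have "terminates_within set_size (init_state m f) (11 * (e + 1)) P1"
      using terminates_within_set_size[of "init_state m f" m]
      unfolding P1_def N_def e_def by (simp add: init_state_def)
    moreover have "11 * (e + 1) \<le> 11 * W" using N mult_le_mono1[of 1 N "e + 1"] by (simp add: W_def)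
    ultimately show ?case by (rule terminates_within_mono)
  next
    case (2 s1)
    show ?case
    proof (rule terminates_within_SEQ[where P = P2], goal_cases)
      case 1
      show ?case
        by (rule terminates_within_mono[OF terminates_within_fill[where n = m and b = 0
              and v = "\<lambda>j. exp (- of_real (f j))"]])
           (use 2 N in \<open>auto simp: P1_def P2_def W_def init_state_def corr_left_def fun_eq_iff
              intro!: fill_cost_le\<close>)
    next
      case (2 s2)
      show ?case
      proof (rule terminates_within_SEQ[where P = P3], goal_cases)
        case 1
        show ?case
          by (rule terminates_within_mono[OF terminates_within_fill[where n = N and b = 0 and v = ?y]])
             (use 2 N m in \<open>auto simp: P2_def P3_def W_def corr_right_def fun_eq_iff
                intro!: fill_cost_le\<close>)
      next
        case (2 s3)
        show ?case
        proof (rule terminates_within_SEQ[where P = P4], goal_cases)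
          case 1
          show ?case
            by (rule terminates_within_mono[OF terminates_within_fft[where e = e]])
               (use 2 in \<open>auto simp: P3_def P4_def W_def N_def\<close>)
        next
          case (2 s4)
          \<comment> \<open>Array 3 is known to agree with \<open>?y\<close> only below
            \<open>N\<close>, which is all the transform reads.\<close>
          then have "dft N (arr s4 3) = dft N ?y" by (intro dft_cong) (simp add: P4_def)
          note 2 = 2 this
          show ?case
          proof (rule terminates_within_SEQ[where P = P5], goal_cases)
            case 1
            show ?case
              by (rule terminates_within_mono[OF terminates_within_fft[where e = e]])
                 (use 2 in \<open>auto simp: P4_def P5_def W_def N_def\<close>)
          next
            case (2 s5)
            show ?case
            proof (rule terminates_within_SEQ[where P = P6], goal_cases)
              case 1
              show ?case
                by (rule terminates_within_mono[OF terminates_within_fill[where n = N and b = 0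
                      and v = "\<lambda>r. dft N ?x r * dft N ?y r"]])
                   (use 2 N in \<open>auto simp: P5_def P6_def W_def intro!: fill_cost_le\<close>)
            next
              case (2 s6)
              then have "dft N (arr s6 4) = dft N (\<lambda>r. dft N ?x r * dft N ?y r)"
                by (intro dft_cong) (simp add: P6_def)
              note 2 = 2 this
              show ?case
              proof (rule terminates_within_SEQ[where P = P7], goal_cases)
                case 1
                show ?case
                  by (rule terminates_within_mono[OF terminates_within_fft[where e = e]])
                     (use 2 in \<open>auto simp: P6_def P7_def W_def N_def\<close>)
              next
                case (2 s7)
                show ?case
                  by (rule terminates_within_mono[OF terminates_within_fill[where n = m and b = 0
                        and v = "\<lambda>k. of_real (sketch (\<lambda>z. exp (- z)) m f k)"]])
                     (use 2 N m in \<open>auto simp: P7_def W_def sketch_exp_conv_dft intro!: fill_cost_le\<close>)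
              qed
            qed
          qed
        qed
      qed
    qed
  qed
qed

theorem theorem3p13:
  shows "\<exists>(prog :: com) (T :: nat \<Rightarrow> nat).
    (\<forall>m > 0. \<forall>f \<in> alg_funs m.
        computes_within prog m f (sketch (\<lambda>z. exp (- z)) m f) (T m)) \<and>
    (\<lambda>m. real (T m)) \<in> O(\<lambda>m. real m * ln (real m))"
  using sketch_prog_correct sketch_time_bigo
  unfolding computes_within_def terminates_within_def by blast

end
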